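(* Let $\Delta_1$ and $\Delta_2$ be two positive integers. Let $G$ be a connected graph and let $V_0=\{v\in V(G): d_G(v)=\Delta_1+\Delta_2\}$. If $\Delta(G)\le \Delta_1+\Delta_2$, then $G$ can be edge-decomposed into two factors $G_1$ and $G_2$ satisfying $\Delta(G_1)\le \Delta_1$ and $\Delta(G_2)\le \Delta_2$, provided that one of the following conditions holds: (1) $\Delta_1$ and $\Delta_2$ are even; (2) $\Delta_1$ is odd and $\Delta_2$ is even, and $G$ is $V_0$-partially odd-$\lceil \frac{\Delta_1+\Delta_2}{\Delta_1 }\rceil$-edge-connected; (3) $\Delta_1$ and $\Delta_2$ are odd, and ($|V(G)|$ is even or $V_0\neq V(G)$), and $G$ is $V_0$-partially odd-$( \lceil \frac{\Delta_1+\Delta_2}{\min \{\Delta_1,\Delta_2\} }\rceil, V_0)$-edge-connected.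
   Context: Graphs may have loops and multiple edges; $d_G(v)$ is the degree of $v$ in $G$ (a loop counts twice), and $\Delta(G)$ is the maximum degree. A factor of $G$ is a spanning subgraph of $G$; $G$ is edge-decomposed into factors if their edge sets partition $E(G)$. For a vertex set $A$, $d_G(A)$ is the number of edges of $G$ with exactly one end in $A$. $G$ is $V_0$-partially odd-$\lambda$-edge-connected if $d_G(A)\ge \lambda$ for all nonempty subsets $A$ of $V_0$ with $d_G(A)$ odd. For a vertex set $Q$, $G$ is $V_0$-partially odd-$(\lambda, Q)$-edge-connected if $d_G(A)\ge \lambda$ for all subsets $A$ of $V_0$ with $|A\cap Q|$ odd. *)

theory Defs
  imports Complex_Main
begin

text \<open>
  Finite undirected graphs with loops and multiple edges. Edges are abstract objects, so parallel
  edges are distinct elements of \<open>edges G\<close> with equal \<open>ends\<close>. An edge \<open>e\<close> is a loop at \<open>v\<close> iff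
  \<open>ends G e = {v}\<close>.
\<close>

record ('v, 'e) multigraph =
  verts :: "'v set"
  edges :: "'e set"
  ends :: "'e \<Rightarrow> 'v set"

definition wf_multigraph :: "('v, 'e) multigraph \<Rightarrow> bool" where
  "wf_multigraph G \<longleftrightarrow>
     finite (verts G) \<and> finite (edges G) \<and>
     (\<forall>e \<in> edges G. ends G e \<subseteq> verts G \<and> card (ends G e) \<in> {1, 2})"

text \<open>The second summand makes every loop count twice.\<close>

definition degree :: "('v, 'e) multigraph \<Rightarrow> 'v \<Rightarrow> nat" where
  "degree G v = card {e \<in> edges G. v \<in> ends G e} + card {e \<in> edges G. ends G e = {v}}"

text \<open>Meaningful only if \<open>verts G\<close> is finite and nonempty.\<close>

definition max_degree :: "('v, 'e) multigraph \<Rightarrow> nat" where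
  "max_degree G = Max (degree G ` verts G)"

definition adj_rel :: "('v, 'e) multigraph \<Rightarrow> ('v \<times> 'v) set" where
  "adj_rel G = {(u, v). \<exists>e \<in> edges G. ends G e = {u, v}}"

text \<open>As usual, the graph without vertices is not regarded as connected.\<close>

definition connected_multigraph :: "('v, 'e) multigraph \<Rightarrow> bool" where
  "connected_multigraph G \<longleftrightarrow>
     verts G \<noteq> {} \<and> (\<forall>u \<in> verts G. \<forall>v \<in> verts G. (u, v) \<in> (adj_rel G)\<^sup>*)"

definition factor_of :: "('v, 'e) multigraph \<Rightarrow> ('v, 'e) multigraph \<Rightarrow> bool" where
  "factor_of H G \<longleftrightarrow>
     verts H = verts G \<and> edges H \<subseteq> edges G \<and> (\<forall>e \<in> edges H. ends H e = ends G e)"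

definition edge_decomposed ::
  "('v, 'e) multigraph \<Rightarrow> ('v, 'e) multigraph \<Rightarrow> ('v, 'e) multigraph \<Rightarrow> bool" where
  "edge_decomposed G G1 G2 \<longleftrightarrow>
     factor_of G1 G \<and> factor_of G2 G \<and>
     edges G1 \<union> edges G2 = edges G \<and> edges G1 \<inter> edges G2 = {}"

text \<open>
  \<open>cut_degree G A\<close> is $d_G(A)$. An edge has exactly one end in \<open>A\<close> iff it has an end in \<open>A\<close> and an
  end outside \<open>A\<close>; loops never qualify.
\<close>

definition cut_degree :: "('v, 'e) multigraph \<Rightarrow> 'v set \<Rightarrow> nat" where
  "cut_degree G A = card {e \<in> edges G. ends G e \<inter> A \<noteq> {} \<and> ends G e - A \<noteq> {}}"

definition partially_odd_edge_connected ::
  "('v, 'e) multigraph \<Rightarrow> 'v set \<Rightarrow> nat \<Rightarrow> bool" where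
  "partially_odd_edge_connected G V\<^sub>0 k \<longleftrightarrow>
     (\<forall>A. A \<subseteq> V\<^sub>0 \<and> A \<noteq> {} \<and> odd (cut_degree G A) \<longrightarrow> cut_degree G A \<ge> k)"

definition partially_odd_edge_connected_wrt ::
  "('v, 'e) multigraph \<Rightarrow> 'v set \<Rightarrow> nat \<Rightarrow> 'v set \<Rightarrow> bool" where
  "partially_odd_edge_connected_wrt G V\<^sub>0 k Q \<longleftrightarrow>
     (\<forall>A. A \<subseteq> V\<^sub>0 \<and> odd (card (A \<inter> Q)) \<longrightarrow> cut_degree G A \<ge> k)"

end

theory Submission
  imports Defs
begin

text \<open>
  Write \<open>d = \<Delta>\<^sub>1 + \<Delta>\<^sub>2\<close>. Putting the fraction \<open>\<Delta>\<^sub>1 / d\<close> of every edge into the first factor and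
  \<open>\<Delta>\<^sub>2 / d\<close> into the second respects both degree bounds, so only integrality is at stake, and the
  obstructions to it are parity conditions on cuts. Only at a vertex of full degree \<open>d\<close> do the
  bounds fix the degree in the first factor, so only sets of such vertices can obstruct.

  The question becomes one about matchings in an auxiliary graph. Every vertex \<open>v\<close> is replaced by \<open>d\<close>
  ports, which are its \<open>degree G v\<close> half-edges and, to make up the number, free ports; all of them
  are joined to \<open>\<Delta>\<^sub>2\<close> dummies of \<open>v\<close>, and the two halves of every edge are joined to each other. In a
  matching that covers all half-edges and all dummies, the edges whose halves are matched to each
  other form the first factor: the half-edges at \<open>v\<close> of the other edges go to the dummies, so there are
  at most \<open>\<Delta>\<^sub>2\<close> of them, and the dummies use up \<open>\<Delta>\<^sub>2\<close> of the \<open>d\<close> ports, which leaves at most \<open>\<Delta>\<^sub>1\<close> for the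
  first factor (\<open>degree_split_of_matching\<close>).

  Such a matching is obtained from the Tutte--Berge theorem (\<open>tutte_berge_witness\<close>) in a weighted form
  (\<open>matching_covering_from_charges\<close>): it exists if every node can distribute a charge of at most \<open>d\<close>
  among its neighbours such that every odd set of nodes that must be covered receives at least \<open>d\<close>
  from outside. The charges are the fractional solution scaled by \<open>d\<close>: \<open>\<Delta>\<^sub>1\<close> between the two halves of
  an edge, \<open>1\<close> between a half-edge and a dummy. Only the free ports, which have no other half, deviate
  and give all of \<open>d\<close> to the dummies.

  The inequality for odd sets is \<open>charge_into_odd\<close>. A set that contains some but not all
  dummies of a vertex receives \<open>d\<close> at that vertex, and a set that contains all dummies of a vertex with
  a free port receives \<open>d\<close> from the free port. What remains is described by the set \<open>A\<close> of vertices,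
  all of degree \<open>d\<close>, whose dummies belong to the odd set. If \<open>a\<close> edges of the cut of \<open>A\<close> have one half
  in the odd set, and \<open>b\<close> have both or none, the set receives at least \<open>\<Delta>\<^sub>1 a + \<Delta>\<^sub>2 b\<close>, unless
  a single edge already yields \<open>d\<close>. This is at least \<open>d\<close> if \<open>a\<close> and \<open>b\<close> are positive. Moreover
  \<open>a + |A| \<Delta>\<^sub>2\<close> and \<open>b + |A| \<Delta>\<^sub>1\<close> are odd. If \<open>\<Delta>\<^sub>1\<close> and \<open>\<Delta>\<^sub>2\<close> are even, this makes \<open>a\<close> and \<open>b\<close> odd, hence positive; otherwise, if one
  of them is zero, the odd edge-connectivity applies to \<open>A\<close> and makes the other one large enough.
\<close>

section \<open>Matchings as involutions\<close>

text \<open>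
  A matching is represented by the involution that exchanges the ends of its edges; the vertices
  that it does not cover are the fixed points. Only the values on \<open>V\<close> matter.
\<close>

definition matching :: "'a set \<Rightarrow> ('a \<Rightarrow> 'a \<Rightarrow> bool) \<Rightarrow> ('a \<Rightarrow> 'a) \<Rightarrow> bool" where
  "matching V E m \<longleftrightarrow> (\<forall>x\<in>V. m x \<in> V \<and> m (m x) = x \<and> (m x \<noteq> x \<longrightarrow> E x (m x)))"

definition missed :: "'a set \<Rightarrow> ('a \<Rightarrow> 'a) \<Rightarrow> 'a set" where
  "missed V m = {x \<in> V. m x = x}"

definition maximum_matching :: "'a set \<Rightarrow> ('a \<Rightarrow> 'a \<Rightarrow> bool) \<Rightarrow> ('a \<Rightarrow> 'a) \<Rightarrow> bool" where
  "maximum_matching V E m \<longleftrightarrow> matching V E m \<and>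
     (\<forall>m'. matching V E m' \<longrightarrow> card (missed V m) \<le> card (missed V m'))"

lemma finite_missed: "finite V \<Longrightarrow> finite (missed V m)"
  by (simp add: missed_def)

lemma maximum_matching_exists: "\<exists>m. maximum_matching V E m"
proof -
  have "matching V E id" by (simp add: matching_def)
  then have "\<exists>m. matching V E m \<and> (\<forall>m'. matching V E m' \<longrightarrow> card (missed V m) \<le> card (missed V m'))"
    by (rule ex_has_least_nat[where P = "matching V E" and m = "\<lambda>m. card (missed V m)"])
  then show ?thesis by (simp add: maximum_matching_def)
qed

text \<open>
  An involution pairs up the points that it moves.
\<close>

lemma even_card_iff_even_missed:
  assumes "finite V" and "\<And>x. x \<in> V \<Longrightarrow> m x \<in> V" and "\<And>x. x \<in> V \<Longrightarrow> m (m x) = x"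
  shows "even (card V) \<longleftrightarrow> even (card (missed V m))"
  using assms
proof (induction V rule: finite_psubset_induct)
  case (psubset V)
  show ?case
  proof (cases "\<exists>x\<in>V. m x \<noteq> x")
    case False
    then have "missed V m = V" by (auto simp: missed_def)
    then show ?thesis by simp
  next
    case True
    then obtain x where x: "x \<in> V" "m x \<noteq> x" by blast
    let ?W = "V - {x, m x}"
    have mx: "m x \<in> V" "m (m x) = x" using psubset.prems x by auto
    have closed: "m y \<in> ?W" if "y \<in> ?W" for y
      using that psubset.prems(1)[of y] psubset.prems(2)[of y] mx by auto
    have "even (card ?W) \<longleftrightarrow> even (card (missed ?W m))"
      using psubset.IH[of ?W] closed psubset.prems(2) x by blast
    moreover have "missed ?W m = missed V m" using x mx by (auto simp: missed_def)
    moreover have "card V = card ?W + 2"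
    proof -
      have "card {x, m x} = 2" using x(2) by (metis card_2_iff)
      moreover have "card ?W = card V - card {x, m x}"
        using x mx by (intro card_Diff_subset) auto
      moreover have "card {x, m x} \<le> card V"
        using x mx psubset.hyps by (intro card_mono) auto
      ultimately show ?thesis by linarith
    qed
    ultimately show ?thesis by simp
  qed
qed

lemma matching_even_card_iff:
  "finite V \<Longrightarrow> matching V E m \<Longrightarrow> even (card V) \<longleftrightarrow> even (card (missed V m))"
  by (rule even_card_iff_even_missed) (auto simp: matching_def)

text \<open>
  The basic exchange: insert the edge between an uncovered vertex \<open>x\<close> and its neighbour \<open>y\<close>, and
  drop the edge that covered \<open>y\<close>, if there is one. In the function update, the last assignment to \<open>y\<close>
  takes precedence, so the case of an uncovered \<open>y\<close> is included.
\<close>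

lemma matching_switch:
  assumes sym: "\<And>x y. E x y \<Longrightarrow> E y x"
    and m: "matching V E m" and x: "x \<in> V" "m x = x" and y: "y \<in> V" "E x y" "y \<noteq> x"
  shows "matching V E (m(m y := m y, x := y, y := x))"
    and "missed V (m(m y := m y, x := y, y := x)) =
      (if m y = y then missed V m - {x, y} else insert (m y) (missed V m - {x}))"
proof -
  have mm: "m z \<in> V" "m (m z) = z" "m z \<noteq> z \<longrightarrow> E z (m z)" if "z \<in> V" for z
    using m that by (auto simp: matching_def)
  have inj: "m z = m w \<longleftrightarrow> z = w" if "z \<in> V" "w \<in> V" for z w
    using mm that by metis
  show "matching V E (m(m y := m y, x := y, y := x))"
    unfolding matching_def
  proof
    fix z assume z: "z \<in> V"
    let ?n = "m(m y := m y, x := y, y := x)"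
    have yy: "m (m y) = y" "m y \<in> V" and my: "m y \<noteq> x" using mm y x inj by metis+
    consider "z = x" | "z = y" | "z = m y" "z \<noteq> y" | "z \<noteq> x" "z \<noteq> y" "z \<noteq> m y" using my by blast
    then show "?n z \<in> V \<and> ?n (?n z) = z \<and> (?n z \<noteq> z \<longrightarrow> E z (?n z))"
    proof cases
      case 4
      then have "m z \<noteq> x" "m z \<noteq> y" "m z \<noteq> m y"
        using inj[OF z x(1)] inj[OF z yy(2)] inj[OF z y(1)] x(2) yy(1) by auto
      then show ?thesis using 4 mm[OF z] by simp
    qed (use x y sym yy my in auto)
  qed
  show "missed V (m(m y := m y, x := y, y := x)) =
      (if m y = y then missed V m - {x, y} else insert (m y) (missed V m - {x}))"
  proof (rule set_eqI)
    fix z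
    have "m (m y) = y" "m y \<in> V" "m y \<noteq> x" using mm y x inj by metis+
    then show "z \<in> missed V (m(m y := m y, x := y, y := x)) \<longleftrightarrow>
      z \<in> (if m y = y then missed V m - {x, y} else insert (m y) (missed V m - {x}))"
      using x y by (cases "z = x"; cases "z = y"; cases "z = m y") (simp_all add: missed_def)
  qed
qed

lemma missed_switch_card:
  assumes "finite V" and "matching V E m" and "x \<in> V" "m x = x" and "y \<in> V" "m y \<noteq> y"
  shows "card (insert (m y) (missed V m - {x})) = card (missed V m)"
proof -
  have "m y \<notin> missed V m" using assms by (auto simp: missed_def matching_def)
  moreover have "x \<in> missed V m" using assms by (auto simp: missed_def)
  ultimately show ?thesis
    using finite_missed[OF assms(1), of m] card.remove[of "missed V m" x] by simp
qed

lemma maximum_matching_no_augment: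
  assumes sym: "\<And>x y. E x y \<Longrightarrow> E y x" and fin: "finite V"
    and max: "maximum_matching V E m" and "x \<in> V" "m x = x" "y \<in> V" "E x y" "y \<noteq> x"
  shows "m y \<noteq> y"
proof
  assume y: "m y = y"
  have m: "matching V E m" using max by (simp add: maximum_matching_def)
  note sw = matching_switch[of E, OF sym m assms(4-8)]
  have "card (missed V m) \<le> card (missed V m - {x, y})"
    using max sw y unfolding maximum_matching_def by (metis (no_types, lifting))
  moreover have "missed V m - {x, y} \<subset> missed V m"
    using assms(4,5) by (auto simp: missed_def)
  ultimately show False
    using psubset_card_mono[OF finite_missed[OF fin, of m]] by (meson leD)
qed

section \<open>The Tutte--Berge theorem\<close>

text \<open>
  This transitivity is the core of Gallai's lemma. If it fails, let \<open>M\<close> miss \<open>u\<close> and \<open>v\<close> and, among the maximum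
  matchings that miss \<open>t\<close>, let \<open>N\<close> share as many edges with \<open>M\<close> as possible. As \<open>N\<close> covers \<open>u\<close> and \<open>v\<close>,
  it misses at least two vertices that \<open>M\<close> covers, and one of them is not \<open>t\<close>. Exchanging the edge of \<open>M\<close>
  at that vertex into \<open>N\<close> keeps \<open>t\<close> uncovered and increases the agreement.
\<close>

lemma never_both_missed_trans:
  assumes sym: "\<And>x y. E x y \<Longrightarrow> E y x" and fin: "finite V"
    and N0: "maximum_matching V E N\<^sub>0" "N\<^sub>0 t = t" and V: "u \<in> V" "v \<in> V" "t \<in> V"
    and neq: "u \<noteq> v"
    and ut: "\<And>m. maximum_matching V E m \<Longrightarrow> m u = u \<Longrightarrow> m t \<noteq> t"
    and tv: "\<And>m. maximum_matching V E m \<Longrightarrow> m v = v \<Longrightarrow> m t \<noteq> t"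
    and M: "maximum_matching V E M"
  shows "\<not> (M u = u \<and> M v = v)"
proof
  assume Muv: "M u = u \<and> M v = v"
  define agree where "agree N = card {x \<in> V. M x \<noteq> x \<and> N x = M x}" for N
  let ?P = "\<lambda>N. maximum_matching V E N \<and> N t = t"
  have "\<exists>N. ?P N \<and> (\<forall>N'. ?P N' \<longrightarrow> agree N' \<le> agree N)"
    by (rule ex_has_greatest_nat[where k = N\<^sub>0 and b = "Suc (card V)"])
      (use N0 fin in \<open>auto simp: agree_def less_Suc_eq_le intro!: card_mono\<close>)
  then obtain N where N: "maximum_matching V E N" "N t = t"
    and best: "\<And>N'. ?P N' \<Longrightarrow> agree N' \<le> agree N" by blast
  have Nuv: "N u \<noteq> u" "N v \<noteq> v" using ut tv N by blast+
  have mM: "matching V E M" and mN: "matching V E N"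
    using M N by (auto simp: maximum_matching_def)
  have cardeq: "card (missed V N) = card (missed V M)"
    using M N by (auto simp: maximum_matching_def intro: antisym)
  have "\<exists>x\<in>missed V N - missed V M. x \<noteq> t"
  proof (rule ccontr)
    assume "\<not> ?thesis"
    then have "missed V N - missed V M \<subseteq> {t}" by blast
    then have "missed V N \<subseteq> insert t (missed V M - {u, v})"
      using Nuv by (auto simp: missed_def)
    then have "card (missed V N) \<le> card (insert t (missed V M - {u, v}))"
      using finite_missed[OF fin] by (intro card_mono) auto
    also have "\<dots> \<le> Suc (card (missed V M - {u, v}))"
      by (simp add: card_insert_le_m1 card_insert_if finite_missed[OF fin])
    also have "card (missed V M - {u, v}) = card (missed V M) - card {u, v}"
      using Muv V by (intro card_Diff_subset) (auto simp: missed_def)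
    also have "card {u, v} = 2" using neq by simp
    finally have "card (missed V N) \<le> Suc (card (missed V M) - 2)" .
    moreover have "card {u, v} \<le> card (missed V M)"
      using Muv V finite_missed[OF fin] by (intro card_mono) (auto simp: missed_def)
    ultimately show False using cardeq neq by simp
  qed
  then obtain x where x: "x \<in> V" "N x = x" "M x \<noteq> x" "x \<noteq> t" by (auto simp: missed_def)
  define y where "y = M x"
  have y: "y \<in> V" "E x y" "y \<noteq> x" "M y = x" using x mM by (auto simp: matching_def y_def)
  have Ny: "N y \<noteq> y" by (rule maximum_matching_no_augment[OF sym fin N(1) x(1,2) y(1-3)])
  define N' where "N' = N(N y := N y, x := y, y := x)"
  note sw = matching_switch[of E, OF sym mN x(1,2) y(1-3), folded N'_def]
  have "card (missed V N') = card (missed V N)"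
    using sw(2) Ny missed_switch_card[OF fin mN x(1,2) y(1) Ny] by simp
  then have "maximum_matching V E N'" using sw(1) N(1) by (simp add: maximum_matching_def)
  moreover have NNy: "N (N y) = y" using mN y(1) by (auto simp: matching_def)
  then have "N' t = t" using N(2) x Ny by (auto simp: N'_def)
  ultimately have "agree N' \<le> agree N" using best by blast
  moreover have "{z \<in> V. M z \<noteq> z \<and> N z = M z} \<subset> {z \<in> V. M z \<noteq> z \<and> N' z = M z}"
  proof
    have "M (N y) \<noteq> y" using mM mN y x by (metis matching_def)
    then show "{z \<in> V. M z \<noteq> z \<and> N z = M z} \<subseteq> {z \<in> V. M z \<noteq> z \<and> N' z = M z}"
      using NNy x y by (auto simp: N'_def y_def)
    have "N' x = M x" "N x \<noteq> M x" using x y by (auto simp: N'_def y_def)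
    then show "{z \<in> V. M z \<noteq> z \<and> N z = M z} \<noteq> {z \<in> V. M z \<noteq> z \<and> N' z = M z}"
      using x by blast
  qed
  then have "agree N < agree N'" unfolding agree_def using fin by (intro psubset_card_mono) auto
  ultimately show False by simp
qed

text \<open>
  The hard half of the Tutte--Berge theorem, with the odd components of \<open>V - U\<close> replaced by disjoint
  odd sets without edges to the rest of \<open>V - U\<close>. The induction moves a vertex that every maximum
  matching covers into \<open>U\<close>. If there is no such vertex, \<open>U\<close> is empty: by Gallai's lemma, never
  being missed by the same maximum matching is an equivalence relation, which contains adjacency.
  Hence a maximum matching runs inside the classes and misses at most one vertex of each, and
  the classes of the vertices that it misses are the odd sets.
\<close>

lemma tutte_berge_witness:
  assumes sym: "\<And>x y. E x y \<Longrightarrow> E y x" and irrefl: "\<And>x. \<not> E x x" and fin: "finite V"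
  shows "\<exists>m U \<C>. matching V E m \<and> U \<subseteq> V \<and> \<C> \<subseteq> Pow (V - U) \<and> pairwise disjnt \<C> \<and>
    (\<forall>C\<in>\<C>. odd (card C) \<and> (\<forall>x\<in>C. \<forall>y\<in>V. E x y \<longrightarrow> y \<in> C \<union> U)) \<and>
    card (missed V m) + card U \<le> card \<C>"
  using fin
proof (induction V rule: finite_psubset_induct)
  case (psubset V)
  obtain m where m: "maximum_matching V E m" using maximum_matching_exists by blast
  then have mm: "matching V E m" by (simp add: maximum_matching_def)
  show ?case
  proof (cases "\<exists>v\<in>V. \<forall>m. maximum_matching V E m \<longrightarrow> m v \<noteq> v")
    case True
    then obtain v where v: "v \<in> V" and cov: "\<And>m. maximum_matching V E m \<Longrightarrow> m v \<noteq> v" by blast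
    have "V - {v} \<subset> V" using v by blast
    then obtain m' U \<C> where m': "matching (V - {v}) E m'" and U: "U \<subseteq> V - {v}"
      and C: "\<C> \<subseteq> Pow (V - {v} - U)" "pairwise disjnt \<C>"
        "\<forall>C\<in>\<C>. odd (card C) \<and> (\<forall>x\<in>C. \<forall>y\<in>V - {v}. E x y \<longrightarrow> y \<in> C \<union> U)"
        "card (missed (V - {v}) m') + card U \<le> card \<C>"
      using psubset.IH by meson
    define m'' where "m'' = m'(v := v)"
    have m'': "matching V E m''"
      using m' unfolding matching_def m''_def by (auto split: if_splits)
    have "missed V m'' = insert v (missed (V - {v}) m')"
      using v by (auto simp: missed_def m''_def)
    moreover have "v \<notin> missed (V - {v}) m'" by (simp add: missed_def)
    ultimately have c: "card (missed V m'') = Suc (card (missed (V - {v}) m'))"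
      using finite_missed[of "V - {v}" m'] psubset.hyps by simp
    \<comment> \<open>A gap of one is not enough to compensate for the larger \<open>U\<close>; parity makes it two.\<close>
    have "\<not> maximum_matching V E m''" using cov[of m''] by (auto simp: m''_def)
    then have "card (missed V m) < card (missed V m'')"
      using m m'' unfolding maximum_matching_def by (meson leI le_trans)
    moreover have "even (card (missed V m)) \<longleftrightarrow> even (card (missed V m''))"
      using matching_even_card_iff[OF psubset.hyps(1)] mm m'' by blast
    ultimately have "card (missed V m) < card (missed (V - {v}) m')"
      using c by (metis even_Suc less_antisym)
    moreover have "card (insert v U) = Suc (card U)"
      using U psubset.hyps by (subst card_insert_disjoint) (auto intro: finite_subset)
    ultimately have "card (missed V m) + card (insert v U) \<le> card \<C>" using C(4) by linarith
    moreover have "\<C> \<subseteq> Pow (V - insert v U)" "insert v U \<subseteq> V" using C(1) U v by auto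
    moreover have "\<forall>C\<in>\<C>. odd (card C) \<and> (\<forall>x\<in>C. \<forall>y\<in>V. E x y \<longrightarrow> y \<in> C \<union> insert v U)"
      using C(3) by blast
    ultimately show ?thesis using mm C(2) by blast
  next
    case False
    define sim where "sim u w \<longleftrightarrow> u = w \<or> (\<forall>m. maximum_matching V E m \<longrightarrow> \<not> (m u = u \<and> m w = w))"
      for u w
    define cls where "cls u = {w \<in> V. sim u w}" for u
    have sim_sym: "sim w u" if "sim u w" for u w using that by (auto simp: sim_def)
    have sim_trans: "sim u w"
      if st: "sim u t" "sim t w" and inV: "u \<in> V" "t \<in> V" "w \<in> V" for u t w
    proof (cases "u = w \<or> u = t \<or> t = w")
      case True
      then show ?thesis using st by (auto simp: sim_def)
    next
      case neq: False
      obtain N where N: "maximum_matching V E N" "N t = t" using False inV(2) by blast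
      show ?thesis
        unfolding sim_def
        using never_both_missed_trans[of E V N t u w, OF sym psubset.hyps(1) N] st inV neq
        by (auto simp: sim_def)
    qed
    have adj_sim: "sim u w" if "E u w" "u \<in> V" "w \<in> V" for u w
      using maximum_matching_no_augment[of E V _ u w, OF sym psubset.hyps(1)] that irrefl
      unfolding sim_def by blast
    let ?C = "cls ` missed V m"
    have inj: "inj_on cls (missed V m)"
    proof
      fix u w assume a: "u \<in> missed V m" "w \<in> missed V m" "cls u = cls w"
      then have "w \<in> cls w" by (auto simp: cls_def sim_def missed_def)
      then have "sim u w" using a by (auto simp: cls_def)
      then show "u = w" using a m by (auto simp: sim_def missed_def)
    qed
    have disj: "pairwise disjnt ?C"
    proof (rule pairwiseI)
      fix C D assume CD: "C \<in> ?C" "D \<in> ?C" "C \<noteq> D"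
      then obtain u w where uw: "C = cls u" "D = cls w" "u \<in> V" "w \<in> V"
        by (auto simp: missed_def)
      show "disjnt C D"
      proof (rule ccontr)
        assume "\<not> disjnt C D"
        then obtain z where z: "z \<in> V" "sim u z" "sim w z"
          using uw by (auto simp: disjnt_def cls_def)
        then have "sim u w" using sim_trans sim_sym uw by meson
        then have "cls u = cls w" using sim_trans sim_sym uw unfolding cls_def by blast
        then show False using uw CD by simp
      qed
    qed
    have closed: "y \<in> cls u" if "x \<in> cls u" "E x y" "y \<in> V" "u \<in> V" for u x y
      using that adj_sim sim_trans unfolding cls_def by blast
    have odd: "odd (card (cls u))" if u: "u \<in> missed V m" for u
    proof -
      have uV: "u \<in> V" using u by (simp add: missed_def)
      have "even (card (cls u)) \<longleftrightarrow> even (card (missed (cls u) m))"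
      proof (rule even_card_iff_even_missed)
        show "finite (cls u)" using psubset.hyps by (simp add: cls_def)
        fix x assume x: "x \<in> cls u"
        then have xV: "x \<in> V" by (simp add: cls_def)
        show "m (m x) = x" using mm xV by (simp add: matching_def)
        show "m x \<in> cls u"
        proof (cases "m x = x")
          case False
          then have "E x (m x)" "m x \<in> V" using mm xV by (auto simp: matching_def)
          then show ?thesis using closed x uV by blast
        qed (use x in simp)
      qed
      moreover have "missed (cls u) m = {u}"
        using u m by (auto simp: missed_def cls_def sim_def)
      ultimately show ?thesis by simp
    qed
    have "card (missed V m) + card {} \<le> card ?C" by (simp add: card_image[OF inj])
    moreover have "?C \<subseteq> Pow (V - {})" by (auto simp: cls_def)
    moreover have "\<forall>C\<in>?C. odd (card C) \<and> (\<forall>x\<in>C. \<forall>y\<in>V. E x y \<longrightarrow> y \<in> C \<union> {})"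
      using odd closed by (auto simp: missed_def)
    ultimately show ?thesis using mm disj by blast
  qed
qed

section \<open>Matchings from charges\<close>

text \<open>
  The sets in \<open>\<C>\<close> receive charge from \<open>U\<close> only. Each needs \<open>D\<close>, and each vertex of \<open>U\<close> gives at
  most \<open>D\<close> to all of them together.
\<close>

lemma charge_bound:
  fixes ch :: "'a \<Rightarrow> 'a \<Rightarrow> nat"
  assumes fin: "finite V" and RV: "R \<subseteq> V"
    and supp: "\<And>u c. ch u c > 0 \<Longrightarrow> E c u"
    and row: "\<And>u. u \<in> V \<Longrightarrow> (\<Sum>c\<in>R. ch u c) \<le> D" and D: "D > 0"
    and odd_charge: "\<And>C. C \<subseteq> R \<Longrightarrow> odd (card C) \<Longrightarrow> D \<le> (\<Sum>c\<in>C. \<Sum>u\<in>V - C. ch u c)"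
    and U: "U \<subseteq> V" and CR: "\<C> \<subseteq> Pow R" and disj: "pairwise disjnt \<C>"
    and C: "\<And>C. C \<in> \<C> \<Longrightarrow> odd (card C)"
    and nb: "\<And>C x y. C \<in> \<C> \<Longrightarrow> x \<in> C \<Longrightarrow> y \<in> V \<Longrightarrow> E x y \<Longrightarrow> y \<in> C \<union> U"
  shows "card \<C> \<le> card U"
proof -
  have finR: "finite R" using fin RV finite_subset by blast
  have finU: "finite U" using fin U finite_subset by blast
  have each: "D \<le> (\<Sum>c\<in>C. \<Sum>u\<in>U. ch u c)" if "C \<in> \<C>" for C
  proof -
    have "D \<le> (\<Sum>c\<in>C. \<Sum>u\<in>V - C. ch u c)" using odd_charge CR C that by blast
    also have "\<dots> \<le> (\<Sum>c\<in>C. \<Sum>u\<in>U. ch u c)"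
    proof (rule sum_mono)
      fix c assume c: "c \<in> C"
      have "(\<Sum>u\<in>V - C. ch u c) = (\<Sum>u\<in>(V - C) \<inter> U. ch u c)"
      proof (rule sum.mono_neutral_right)
        show "\<forall>u\<in>V - C - (V - C) \<inter> U. ch u c = 0"
          using supp nb[OF that c] by fastforce
      qed (use fin in auto)
      also have "\<dots> \<le> (\<Sum>u\<in>U. ch u c)" using finU by (intro sum_mono2) auto
      finally show "(\<Sum>u\<in>V - C. ch u c) \<le> (\<Sum>u\<in>U. ch u c)" .
    qed
    finally show ?thesis .
  qed
  have "card \<C> * D = (\<Sum>C\<in>\<C>. D)" by simp
  also have "\<dots> \<le> (\<Sum>C\<in>\<C>. \<Sum>c\<in>C. \<Sum>u\<in>U. ch u c)" using each by (rule sum_mono)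
  also have "\<dots> = (\<Sum>c\<in>\<Union>\<C>. \<Sum>u\<in>U. ch u c)"
  proof -
    have "\<forall>A\<in>\<C>. finite A" using CR finR finite_subset by blast
    moreover have "\<forall>A\<in>\<C>. \<forall>B\<in>\<C>. A \<noteq> B \<longrightarrow> A \<inter> B = {}"
      using disj by (auto simp: pairwise_def disjnt_def)
    ultimately show ?thesis by (simp add: sum.Union_disjoint)
  qed
  also have "\<dots> \<le> (\<Sum>c\<in>R. \<Sum>u\<in>U. ch u c)" using CR finR by (intro sum_mono2) auto
  also have "\<dots> = (\<Sum>u\<in>U. \<Sum>c\<in>R. ch u c)" by (rule sum.swap)
  also have "\<dots> \<le> (\<Sum>u\<in>U. D)" using row U by (intro sum_mono) auto
  finally have "card \<C> * D \<le> card U * D" by simp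
  then show ?thesis using D by simp
qed

text \<open>
  The optional vertices, those outside \<open>R\<close>, are made pairwise adjacent, so that a perfect matching of
  the larger graph can pair those that are left over. The extra vertex \<open>None\<close>, present if it is needed to make the
  number of vertices even, is treated in the same way. As the optional vertices form a clique, at most one
  of the disjoint sets of a Tutte--Berge witness contains any of them. By the charges, the other sets are
  at most as many as the vertices of \<open>U\<close>, so a maximum matching misses at most one vertex, and by
  parity none.
\<close>

theorem matching_covering_from_charges:
  fixes ch :: "'a \<Rightarrow> 'a \<Rightarrow> nat"
  assumes sym: "\<And>x y. E x y \<Longrightarrow> E y x" and irrefl: "\<And>x. \<not> E x x"
    and fin: "finite V" and RV: "R \<subseteq> V"
    and supp: "\<And>u c. ch u c > 0 \<Longrightarrow> E c u"
    and row: "\<And>u. u \<in> V \<Longrightarrow> (\<Sum>c\<in>R. ch u c) \<le> D" and D: "D > 0"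
    and odd_charge: "\<And>C. C \<subseteq> R \<Longrightarrow> odd (card C) \<Longrightarrow> D \<le> (\<Sum>c\<in>C. \<Sum>u\<in>V - C. ch u c)"
  shows "\<exists>m. matching V E m \<and> (\<forall>x\<in>R. m x \<noteq> x)"
proof -
  define free where "free p \<longleftrightarrow> p \<notin> Some ` R" for p :: "'a option"
  define E' where "E' p q \<longleftrightarrow> (\<exists>x y. p = Some x \<and> q = Some y \<and> E x y) \<or> (p \<noteq> q \<and> free p \<and> free q)"
    for p q
  define V' where "V' = Some ` V \<union> (if odd (card V) then {None} else {})"
  have finV': "finite V'" using fin by (simp add: V'_def)
  have cV: "card (Some ` V) = card V" by (simp add: card_image)
  have evenV': "even (card V')"
    using fin cV by (simp add: V'_def)
  have "\<exists>m U \<C>. matching V' E' m \<and> U \<subseteq> V' \<and> \<C> \<subseteq> Pow (V' - U) \<and> pairwise disjnt \<C> \<and>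
    (\<forall>C\<in>\<C>. odd (card C) \<and> (\<forall>x\<in>C. \<forall>y\<in>V'. E' x y \<longrightarrow> y \<in> C \<union> U)) \<and>
    card (missed V' m) + card U \<le> card \<C>"
    by (rule tutte_berge_witness) (use sym irrefl finV' in \<open>auto simp: E'_def\<close>)
  then obtain m U \<C> where m: "matching V' E' m" and U: "U \<subseteq> V'" and C: "\<C> \<subseteq> Pow (V' - U)"
      and disj: "pairwise disjnt \<C>"
      and odd_closed: "\<forall>C\<in>\<C>. odd (card C) \<and> (\<forall>x\<in>C. \<forall>y\<in>V'. E' x y \<longrightarrow> y \<in> C \<union> U)"
      and card: "card (missed V' m) + card U \<le> card \<C>"
    by (elim exE conjE) (rule that; assumption)
  have odd: "odd (card C)" if "C \<in> \<C>" for C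
    using odd_closed that by simp
  have nb: "y \<in> C \<union> U" if "C \<in> \<C>" "x \<in> C" "y \<in> V'" "E' x y" for C x y
    using bspec[OF odd_closed that(1)] that by simp
  have finC: "finite \<C>" using C finV' by (meson finite_Diff finite_Pow_iff finite_subset)
  have finU: "finite U" using U finV' finite_subset by blast
  define \<R> where "\<R> = {C \<in> \<C>. C \<subseteq> Some ` R}"
  \<comment> \<open>Optional vertices in two different sets would be adjacent.\<close>
  have "card (\<C> - \<R>) \<le> 1"
  proof (rule ccontr)
    assume "\<not> ?thesis"
    then obtain C D where CD: "C \<in> \<C> - \<R>" "D \<in> \<C> - \<R>" "C \<noteq> D"
      using finC by (metis (no_types, lifting) card_le_Suc0_iff_eq finite_Diff One_nat_def)
    then obtain p q where pq: "p \<in> C" "free p" "q \<in> D" "free q" by (auto simp: \<R>_def free_def)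
    have dj: "C \<inter> D = {}" using CD disj by (auto simp: pairwise_def disjnt_def)
    have "q \<in> V'" "q \<notin> U" using CD pq C by auto
    moreover have "E' p q" using pq dj by (auto simp: E'_def)
    ultimately have "q \<in> C" using nb[of C p q] CD pq by auto
    then show False using dj pq by auto
  qed
  moreover have "card \<C> = card \<R> + card (\<C> - \<R>)"
  proof -
    have "\<R> \<subseteq> \<C>" by (auto simp: \<R>_def)
    then show ?thesis using finC by (simp add: card_Diff_subset finite_subset card_mono)
  qed
  ultimately have le: "card \<C> \<le> Suc (card \<R>)" by simp
  have "card ((`) the ` \<R>) \<le> card (the ` (U \<inter> Some ` V))"
  proof (rule charge_bound[of V R ch E D, OF fin RV supp row D odd_charge])
    show "the ` (U \<inter> Some ` V) \<subseteq> V" by auto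
    show "(`) the ` \<R> \<subseteq> Pow R" by (auto simp: \<R>_def)
    have the_mem: "x \<in> the ` C \<longleftrightarrow> Some x \<in> C" if "C \<in> \<R>" for C x
      using that by (force simp: \<R>_def)
    show "pairwise disjnt ((`) the ` \<R>)"
    proof (rule pairwiseI)
      fix A B assume AB: "A \<in> (`) the ` \<R>" "B \<in> (`) the ` \<R>" "A \<noteq> B"
      then obtain C D where CD: "C \<in> \<R>" "D \<in> \<R>" "A = the ` C" "B = the ` D" by blast
      moreover have "C \<noteq> D" using AB CD by blast
      ultimately have "disjnt C D" using disj by (auto simp: pairwise_def \<R>_def)
      then show "disjnt A B"
        using the_mem[OF CD(1)] the_mem[OF CD(2)] CD(3,4) unfolding disjnt_iff by blast
    qed
    fix A assume "A \<in> (`) the ` \<R>"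
    then obtain C where C': "C \<in> \<R>" "A = the ` C" by blast
    have "inj_on the (Some ` R)" by (auto simp: inj_on_def)
    then have "inj_on the C" using C'(1) by (auto simp: \<R>_def intro: inj_on_subset)
    then show "odd (card A)" using C' odd by (simp add: card_image \<R>_def)
    fix x y assume xy: "x \<in> A" "y \<in> V" "E x y"
    have "E' (Some x) (Some y)" "Some y \<in> V'" using xy by (auto simp: E'_def V'_def)
    then have "Some y \<in> C \<union> U" using nb[of C "Some x" "Some y"] C' the_mem[OF C'(1)] xy
      by (auto simp: \<R>_def)
    then show "y \<in> A \<union> the ` (U \<inter> Some ` V)" using xy C' the_mem[OF C'(1)] by force
  qed
  moreover have "card ((`) the ` \<R>) = card \<R>"
  proof (rule card_image)
    have "Some ` the ` C = C" if "C \<in> \<R>" for C using that by (force simp: \<R>_def)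
    then show "inj_on ((`) the) \<R>" by (metis (no_types, lifting) inj_onI)
  qed
  moreover have "card (the ` (U \<inter> Some ` V)) \<le> card U"
    using finU by (meson card_image_le card_mono finite_Int inf_le1 le_trans)
  ultimately have "card (missed V' m) \<le> 1" using le card by linarith
  moreover have "even (card (missed V' m))"
    using matching_even_card_iff[OF finV' m] evenV' by blast
  ultimately have "card (missed V' m) = 0" by (metis even_zero le_Suc_eq le_zero_eq odd_one One_nat_def)
  then have no_miss: "m p \<noteq> p" if "p \<in> V'" for p
    using that finite_missed[OF finV', of m] by (auto simp: missed_def)
  \<comment> \<open>Forget the pairs that are matched along the added clique edges.\<close>
  define n where "n x = (case m (Some x) of Some y \<Rightarrow> if E x y then y else x | None \<Rightarrow> x)" for x
  have mm: "m p \<in> V' \<and> m (m p) = p \<and> (m p \<noteq> p \<longrightarrow> E' p (m p))" if "p \<in> V'" for p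
    using m that by (auto simp: matching_def)
  have "matching V E n"
    unfolding matching_def
  proof
    fix x assume x: "x \<in> V"
    then have "Some x \<in> V'" by (simp add: V'_def)
    note mx = mm[OF this]
    show "n x \<in> V \<and> n (n x) = x \<and> (n x \<noteq> x \<longrightarrow> E x (n x))"
    proof (cases "\<exists>y. m (Some x) = Some y \<and> E x y")
      case True
      then obtain y where y: "m (Some x) = Some y" "E x y" by blast
      then have "m (Some y) = Some x" "y \<in> V" using mx by (auto simp: V'_def split: if_splits)
      then show ?thesis using y sym[OF y(2)] by (simp add: n_def)
    next
      case False
      then have "n x = x" by (auto simp: n_def split: option.splits)
      then show ?thesis using x by simp
    qed
  qed
  moreover have "n x \<noteq> x" if x: "x \<in> R" for x
  proof -
    have V: "Some x \<in> V'" using x RV by (auto simp: V'_def)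
    have "E' (Some x) (m (Some x))" using mm[OF V] no_miss[OF V] by blast
    then obtain y where "m (Some x) = Some y" "E x y" using x by (auto simp: E'_def free_def)
    then show ?thesis using irrefl by (auto simp: n_def)
  qed
  ultimately show ?thesis by blast
qed

section \<open>The gadget\<close>

text \<open>
  The two halves of an edge \<open>e\<close> are told apart by a Boolean, and \<open>tip e b\<close> is the vertex at the
  half \<open>b\<close>. A loop thus has two halves at the same vertex, so that degrees simply count half-edges.
  The numbers in the other constructors only tell the free ports, or the dummies, of a vertex apart.
\<close>

datatype ('v, 'e) gadget = Half 'e bool | Free 'v nat | Dummy 'v nat

fun gadget_adj :: "('e \<Rightarrow> bool \<Rightarrow> 'v) \<Rightarrow> ('v, 'e) gadget \<Rightarrow> ('v, 'e) gadget \<Rightarrow> bool" where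
  "gadget_adj tip (Half e b) (Half e' b') \<longleftrightarrow> e = e' \<and> b \<noteq> b'"
| "gadget_adj tip (Half e b) (Dummy v j) \<longleftrightarrow> tip e b = v"
| "gadget_adj tip (Dummy v j) (Half e b) \<longleftrightarrow> tip e b = v"
| "gadget_adj tip (Free v i) (Dummy w j) \<longleftrightarrow> v = w"
| "gadget_adj tip (Dummy w j) (Free v i) \<longleftrightarrow> v = w"
| "gadget_adj tip _ _ \<longleftrightarrow> False"

text \<open>
  A half-edge gives \<open>d\<close> to its other half. A free port has none and gives this amount to the dummy with
  index \<open>0\<close> instead, an arbitrary choice: what matters is that the dummies of the vertex together
  receive from a free port as much as a half-edge gives away in total.
\<close>

fun gadget_charge :: "nat \<Rightarrow> ('e \<Rightarrow> bool \<Rightarrow> 'v) \<Rightarrow> ('v, 'e) gadget \<Rightarrow> ('v, 'e) gadget \<Rightarrow> nat" where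
  "gadget_charge d tip (Half e b) (Half e' b') = (if e = e' \<and> b \<noteq> b' then d else 0)"
| "gadget_charge d tip (Half e b) (Dummy v j) = (if tip e b = v then 1 else 0)"
| "gadget_charge d tip (Dummy v j) (Half e b) = (if tip e b = v then 1 else 0)"
| "gadget_charge d tip (Free v i) (Dummy w j) =
    (if v = w then if j = 0 then Suc d else 1 else 0)"
| "gadget_charge d tip _ _ = 0"

lemma gadget_adj_sym: "gadget_adj tip x y \<Longrightarrow> gadget_adj tip y x"
  by (cases x; cases y) auto

lemma gadget_adj_irrefl: "\<not> gadget_adj tip x x"
  by (cases x) auto

lemma gadget_charge_adj: "gadget_charge d tip u c > 0 \<Longrightarrow> gadget_adj tip c u"
  by (cases u; cases c) (auto split: if_splits)

section \<open>Half-edges, degrees and cuts\<close>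

locale oriented_multigraph =
  fixes G :: "('v, 'e) multigraph" and tip :: "'e \<Rightarrow> bool \<Rightarrow> 'v"
  assumes wf: "wf_multigraph G"
    and ends_tip: "e \<in> edges G \<Longrightarrow> ends G e = {tip e True, tip e False}"
begin

lemma finite_verts: "finite (verts G)" and finite_edges: "finite (edges G)"
  using wf by (auto simp: wf_multigraph_def)

lemma tip_in_verts: "e \<in> edges G \<Longrightarrow> tip e b \<in> verts G"
  using wf ends_tip[of e] by (cases b) (auto simp: wf_multigraph_def)

text \<open>
  If \<open>X\<close> and \<open>Y\<close> are the sets of edges whose first or second half is at \<open>v\<close>, the two summands of the
  degree are the cardinalities of \<open>X \<union> Y\<close> and \<open>X \<inter> Y\<close>.
\<close>

lemma degree_eq_card_half_edges:
  assumes "F \<subseteq> edges G"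
  shows "degree (G\<lparr>edges := F\<rparr>) v = card {(e, b). e \<in> F \<and> tip e b = v}"
proof -
  have fin: "finite F" using assms finite_edges finite_subset by blast
  let ?X = "{e \<in> F. tip e True = v}" and ?Y = "{e \<in> F. tip e False = v}"
  have "{e \<in> F. v \<in> ends G e} = ?X \<union> ?Y" "{e \<in> F. ends G e = {v}} = ?X \<inter> ?Y"
    using assms ends_tip by auto
  then have "degree (G\<lparr>edges := F\<rparr>) v = card (?X \<union> ?Y) + card (?X \<inter> ?Y)"
    by (simp add: degree_def)
  also have "\<dots> = card ?X + card ?Y" by (rule card_Un_Int[symmetric]) (use fin in auto)
  also have "\<dots> = card ((\<lambda>e. (e, True)) ` ?X) + card ((\<lambda>e. (e, False)) ` ?Y)"
    by (simp add: card_image inj_on_def)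
  also have "\<dots> = card ((\<lambda>e. (e, True)) ` ?X \<union> (\<lambda>e. (e, False)) ` ?Y)"
    using fin by (intro card_Un_disjoint[symmetric]) auto
  also have "(\<lambda>e. (e, True)) ` ?X \<union> (\<lambda>e. (e, False)) ` ?Y = {(e, b). e \<in> F \<and> tip e b = v}"
  proof (rule set_eqI, clarify)
    fix e b
    show "(e, b) \<in> (\<lambda>e. (e, True)) ` ?X \<union> (\<lambda>e. (e, False)) ` ?Y \<longleftrightarrow>
        (e, b) \<in> {(e, b). e \<in> F \<and> tip e b = v}"
      by (cases b) auto
  qed
  finally show ?thesis .
qed

lemma cut_degree_eq:
  "cut_degree G A = card {e \<in> edges G. (tip e True \<in> A) \<noteq> (tip e False \<in> A)}"
proof -
  have "{e \<in> edges G. ends G e \<inter> A \<noteq> {} \<and> ends G e - A \<noteq> {}} =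
      {e \<in> edges G. (tip e True \<in> A) \<noteq> (tip e False \<in> A)}"
    using ends_tip by auto
  then show ?thesis by (simp add: cut_degree_def)
qed

lemma card_half_edges:
  assumes "H \<subseteq> edges G \<times> UNIV"
  shows "card H = (\<Sum>e\<in>edges G. of_bool ((e, True) \<in> H) + of_bool ((e, False) \<in> H))"
proof -
  have "card H = (\<Sum>h\<in>edges G \<times> UNIV. of_bool (h \<in> H))"
    using assms finite_edges
    by (simp add: of_bool_def sum.If_cases Int_absorb1 Int_absorb2 flip: card_eq_sum)
  also have "\<dots> = (\<Sum>e\<in>edges G. \<Sum>b\<in>UNIV. of_bool ((e, b) \<in> H))"
    unfolding sum.cartesian_product by (simp add: case_prod_unfold)
  also have "\<dots> = (\<Sum>e\<in>edges G. of_bool ((e, True) \<in> H) + of_bool ((e, False) \<in> H))"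
    by (intro sum.cong refl) (simp only: UNIV_bool, simp add: add.commute)
  finally show ?thesis .
qed

lemma even_card_half_edges:
  assumes "H \<subseteq> edges G \<times> UNIV"
  shows "even (card H) \<longleftrightarrow> even (card {e \<in> edges G. ((e, True) \<in> H) \<noteq> ((e, False) \<in> H)})"
proof -
  have "{e \<in> edges G. odd (of_bool ((e, True) \<in> H) + of_bool ((e, False) \<in> H) :: nat)} =
      {e \<in> edges G. ((e, True) \<in> H) \<noteq> ((e, False) \<in> H)}"
    by auto
  then show ?thesis
    unfolding card_half_edges[OF assms] by (simp only: even_sum_iff[OF finite_edges])
qed

text \<open>
  Edges inside \<open>A\<close> contribute two half-edges, and edges of the cut contribute one.
\<close>

lemma even_sum_degree_iff:
  assumes "A \<subseteq> verts G"
  shows "even (\<Sum>v\<in>A. degree G v) \<longleftrightarrow> even (cut_degree G A)"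
proof -
  have fin: "finite A" using assms finite_verts finite_subset by blast
  let ?H = "{(e, b). e \<in> edges G \<and> tip e b \<in> A}"
  have finH: "finite {(e, b). e \<in> edges G \<and> tip e b = v}" for v
    by (rule finite_subset[of _ "edges G \<times> UNIV"]) (use finite_edges in auto)
  have "(\<Sum>v\<in>A. degree G v) = (\<Sum>v\<in>A. card {(e, b). e \<in> edges G \<and> tip e b = v})"
    using degree_eq_card_half_edges[of "edges G"] by simp
  also have "\<dots> = card (\<Union>v\<in>A. {(e, b). e \<in> edges G \<and> tip e b = v})"
    using fin finH by (intro card_UN_disjoint[symmetric]) auto
  also have "(\<Union>v\<in>A. {(e, b). e \<in> edges G \<and> tip e b = v}) = ?H" by auto
  finally have "(\<Sum>v\<in>A. degree G v) = card ?H" .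
  moreover have "even (card ?H) \<longleftrightarrow>
      even (card {e \<in> edges G. ((e, True) \<in> ?H) \<noteq> ((e, False) \<in> ?H)})"
    by (rule even_card_half_edges) auto
  moreover have "{e \<in> edges G. ((e, True) \<in> ?H) \<noteq> ((e, False) \<in> ?H)} =
      {e \<in> edges G. (tip e True \<in> A) \<noteq> (tip e False \<in> A)}" by auto
  ultimately show ?thesis by (simp add: cut_degree_eq)
qed

end

section \<open>From matchings in the gadget to factors\<close>

locale degree_gadget = oriented_multigraph G tip
  for G :: "('v, 'e) multigraph" and tip +
  fixes d\<^sub>1 d\<^sub>2 :: nat
  assumes degree_le: "v \<in> verts G \<Longrightarrow> degree G v \<le> d\<^sub>1 + d\<^sub>2"
    and pos: "d\<^sub>1 > 0" "d\<^sub>2 > 0"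
begin

definition halves :: "('v, 'e) gadget set" where
  "halves = (\<lambda>(e, b). Half e b) ` (edges G \<times> UNIV)"

definition dummies :: "('v, 'e) gadget set" where
  "dummies = (\<lambda>(v, j). Dummy v j) ` (verts G \<times> {..<d\<^sub>2})"

definition frees :: "('v, 'e) gadget set" where
  "frees = (\<lambda>(v, i). Free v i) ` (SIGMA v:verts G. {..<d\<^sub>1 + d\<^sub>2 - degree G v})"

abbreviation "required \<equiv> halves \<union> dummies"
abbreviation "nodes \<equiv> halves \<union> dummies \<union> frees"
abbreviation "charge \<equiv> gadget_charge d\<^sub>1 tip"

definition ports :: "'v \<Rightarrow> ('v, 'e) gadget set" where
  "ports v = {Half e b | e b. e \<in> edges G \<and> tip e b = v} \<union> Free v ` {..<d\<^sub>1 + d\<^sub>2 - degree G v}"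

lemma mem_simps [simp]:
  "Half e b \<in> halves \<longleftrightarrow> e \<in> edges G" "Half e b \<notin> dummies" "Half e b \<notin> frees"
  "Dummy v j \<in> dummies \<longleftrightarrow> v \<in> verts G \<and> j < d\<^sub>2" "Dummy v j \<notin> halves" "Dummy v j \<notin> frees"
  "Free v i \<in> frees \<longleftrightarrow> v \<in> verts G \<and> i < d\<^sub>1 + d\<^sub>2 - degree G v"
  "Free v i \<notin> halves" "Free v i \<notin> dummies"
  by (auto simp: halves_def dummies_def frees_def)

lemma halves_dummies_disjoint: "halves \<inter> dummies = {}"
  by (auto simp: halves_def dummies_def)

lemma finite_nodes: "finite halves" "finite dummies" "finite frees"
  using finite_verts finite_edges by (auto simp: halves_def dummies_def frees_def)

lemma card_Half_image:
  "card {Half e b :: ('v, 'e) gadget | e b. e \<in> F \<and> P e b} = card {(e, b). e \<in> F \<and> P e b}"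
proof -
  have "{Half e b :: ('v, 'e) gadget | e b. e \<in> F \<and> P e b} =
      (\<lambda>(e, b). Half e b) ` {(e, b). e \<in> F \<and> P e b}"
    by auto
  moreover have "inj_on (\<lambda>(e, b). Half e b :: ('v, 'e) gadget) X" for X
    by (auto simp: inj_on_def)
  ultimately show ?thesis by (simp add: card_image)
qed

lemma card_ports: "v \<in> verts G \<Longrightarrow> card (ports v) = d\<^sub>1 + d\<^sub>2"
proof -
  assume v: "v \<in> verts G"
  have fin: "finite {Half e b :: ('v, 'e) gadget | e b. e \<in> edges G \<and> tip e b = v}"
    by (rule finite_subset[OF _ finite_nodes(1)]) auto
  have "card (ports v) = card {Half e b :: ('v, 'e) gadget | e b. e \<in> edges G \<and> tip e b = v}
      + card (Free v ` {..<d\<^sub>1 + d\<^sub>2 - degree G v} :: ('v, 'e) gadget set)"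
    unfolding ports_def using fin by (intro card_Un_disjoint) auto
  also have "card (Free v ` {..<d\<^sub>1 + d\<^sub>2 - degree G v} :: ('v, 'e) gadget set)
      = d\<^sub>1 + d\<^sub>2 - degree G v"
    by (simp add: card_image inj_on_def)
  also have "card {Half e b :: ('v, 'e) gadget | e b. e \<in> edges G \<and> tip e b = v} = degree G v"
    using degree_eq_card_half_edges[of "edges G" v] by (simp add: card_Half_image)
  finally show ?thesis using degree_le[OF v] by simp
qed

lemma ports_subset_nodes: "v \<in> verts G \<Longrightarrow> ports v \<subseteq> halves \<union> frees"
  by (auto simp: ports_def)

lemma sum_halves: "(\<Sum>x\<in>halves. f x) = (\<Sum>e\<in>edges G. \<Sum>b\<in>UNIV. f (Half e b))"
proof -
  have "inj_on (\<lambda>(e, b). Half e b :: ('v, 'e) gadget) (edges G \<times> UNIV)"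
    by (auto simp: inj_on_def)
  then have "(\<Sum>x\<in>halves. f x) = (\<Sum>h\<in>edges G \<times> UNIV. f (case h of (e, b) \<Rightarrow> Half e b))"
    unfolding halves_def by (simp only: sum.reindex comp_def)
  then show ?thesis unfolding sum.cartesian_product by (simp only: case_prod_unfold)
qed

lemma sum_dummies: "(\<Sum>x\<in>dummies. f x) = (\<Sum>v\<in>verts G. \<Sum>j<d\<^sub>2. f (Dummy v j))"
proof -
  have "inj_on (\<lambda>(v, j). Dummy v j :: ('v, 'e) gadget) (verts G \<times> {..<d\<^sub>2})"
    by (auto simp: inj_on_def)
  then have "(\<Sum>x\<in>dummies. f x) =
      (\<Sum>h\<in>verts G \<times> {..<d\<^sub>2}. f (case h of (v, j) \<Rightarrow> Dummy v j))"
    unfolding dummies_def by (simp only: sum.reindex comp_def)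
  then show ?thesis unfolding sum.cartesian_product by (simp only: case_prod_unfold)
qed

lemma charge_row_le:
  assumes "u \<in> nodes"
  shows "(\<Sum>c\<in>required. charge u c) \<le> d\<^sub>1 + d\<^sub>2"
proof -
  have split: "(\<Sum>c\<in>required. charge u c) = (\<Sum>c\<in>halves. charge u c) + (\<Sum>c\<in>dummies. charge u c)"
    using finite_nodes halves_dummies_disjoint by (intro sum.union_disjoint)
  show ?thesis
  proof (cases u)
    case (Half e b)
    have "(\<Sum>c\<in>halves. charge u c) = (\<Sum>e'\<in>edges G. if e = e' then d\<^sub>1 else 0)"
      unfolding sum_halves Half by (intro sum.cong) (cases b; auto simp: UNIV_bool)+
    also have "\<dots> \<le> d\<^sub>1" using finite_edges by simp
    moreover have "(\<Sum>c\<in>dummies. charge u c) = (\<Sum>v\<in>verts G. if tip e b = v then d\<^sub>2 else 0)"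
      unfolding sum_dummies Half by (intro sum.cong) auto
    moreover have "\<dots> \<le> d\<^sub>2" using finite_verts by simp
    ultimately show ?thesis using split by linarith
  next
    case (Dummy v j)
    then have v: "v \<in> verts G" using assms by auto
    have "(\<Sum>c\<in>dummies. charge u c) = 0" unfolding sum_dummies Dummy by simp
    moreover have "(\<Sum>c\<in>halves. charge u c) = (\<Sum>c\<in>halves. of_bool (\<exists>e b. c = Half e b \<and> tip e b = v))"
      unfolding Dummy by (intro sum.cong) (auto simp: halves_def)
    moreover have "\<dots> = card (halves \<inter> {c. \<exists>e b. c = Half e b \<and> tip e b = v})"
      using finite_nodes by (simp add: of_bool_def sum.If_cases)
    moreover have "\<dots> \<le> card (ports v)"
    proof (rule card_mono)
      show "finite (ports v)" using card_ports[OF v] pos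
        by (metis add_gr_0 card.infinite less_numeral_extra(3))
    qed (auto simp: ports_def)
    ultimately show ?thesis using split card_ports[OF v] by linarith
  next
    case (Free v i)
    have "(\<Sum>c\<in>halves. charge u c) = 0" unfolding sum_halves Free by simp
    moreover have "(\<Sum>c\<in>dummies. charge u c) = (\<Sum>w\<in>verts G. if v = w then d\<^sub>1 + d\<^sub>2 else 0)"
      unfolding sum_dummies Free
    proof (rule sum.cong)
      fix w
      obtain k where k: "d\<^sub>2 = Suc k" using pos by (cases d\<^sub>2) auto
      show "(\<Sum>j<d\<^sub>2. charge (Free v i) (Dummy w j)) = (if v = w then d\<^sub>1 + d\<^sub>2 else 0)"
        unfolding k by (simp add: sum.lessThan_Suc_shift del: sum.lessThan_Suc)
    qed simp
    moreover have "\<dots> \<le> d\<^sub>1 + d\<^sub>2" using finite_verts by simp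
    ultimately show ?thesis using split by linarith
  qed
qed

text \<open>
  A half-edge can be matched to its other half or to a dummy of its vertex. In the second case it
  occupies one of \<open>d\<^sub>2\<close> dummies, which bounds the degree outside \<open>F\<close>. All \<open>d\<^sub>2\<close> dummies are matched to ports
  of their vertex, and these ports are not half-edges of \<open>F\<close>, which bounds the degree in \<open>F\<close>.
\<close>

lemma degree_split_of_matching:
  assumes m: "matching nodes (gadget_adj tip) m" and cover: "\<And>x. x \<in> required \<Longrightarrow> m x \<noteq> x"
  shows "\<exists>F\<subseteq>edges G. \<forall>v\<in>verts G. degree (G\<lparr>edges := F\<rparr>) v \<le> d\<^sub>1
    \<and> degree (G\<lparr>edges := edges G - F\<rparr>) v \<le> d\<^sub>2"
proof -
  define F where "F = {e \<in> edges G. m (Half e True) = Half e False}"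
  have mm: "m x \<in> nodes" "m (m x) = x" if "x \<in> nodes" for x
    using m that by (auto simp: matching_def)
  have adj: "gadget_adj tip x (m x)" if "x \<in> required" for x
    using m cover[OF that] that by (auto simp: matching_def)
  have inj: "inj_on m nodes" by (metis inj_onI mm(2))
  have F_iff: "e \<in> F \<longleftrightarrow> m (Half e b) = Half e (\<not> b)" if "e \<in> edges G" for e b
    using that mm(2)[of "Half e True"] mm(2)[of "Half e False"] by (cases b) (auto simp: F_def)
  have "degree (G\<lparr>edges := edges G - F\<rparr>) v \<le> d\<^sub>2" if v: "v \<in> verts G" for v
  proof -
    let ?H = "{Half e b :: ('v, 'e) gadget | e b. e \<in> edges G - F \<and> tip e b = v}"
    have "m ` ?H \<subseteq> Dummy v ` {..<d\<^sub>2}"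
    proof clarify
      fix e b assume e: "e \<in> edges G" "e \<notin> F" "v = tip e b"
      have a: "gadget_adj tip (Half e b) (m (Half e b))" "m (Half e b) \<in> nodes"
        using adj[of "Half e b"] mm[of "Half e b"] e by auto
      show "m (Half e b) \<in> Dummy (tip e b) ` {..<d\<^sub>2}"
        using a F_iff[OF e(1), of b] e by (cases "m (Half e b)") auto
    qed
    then have "card ?H \<le> card (Dummy v ` {..<d\<^sub>2} :: ('v, 'e) gadget set)"
      by (intro card_inj_on_le[of m ?H] inj_on_subset[OF inj]) auto
    also have "\<dots> = d\<^sub>2" by (simp add: card_image inj_on_def)
    finally show ?thesis
      using degree_eq_card_half_edges[OF Diff_subset, of F v] by (simp only: card_Half_image)
  qed
  moreover have "degree (G\<lparr>edges := F\<rparr>) v \<le> d\<^sub>1" if v: "v \<in> verts G" for v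
  proof -
    let ?H = "{Half e b :: ('v, 'e) gadget | e b. e \<in> F \<and> tip e b = v}"
    let ?D = "Dummy v ` {..<d\<^sub>2} :: ('v, 'e) gadget set"
    have finP: "finite (ports v)"
      using ports_subset_nodes[OF v] finite_nodes by (meson finite_UnI finite_subset)
    have D: "m x \<in> ports v" "m x \<notin> ?H" if x: "x \<in> ?D" for x
    proof -
      obtain j where j: "x = Dummy v j" "j < d\<^sub>2" using x by auto
      have a: "gadget_adj tip (Dummy v j) (m x)" "m x \<in> nodes" "m (m x) = x"
        using adj[of x] mm[of x] j v by auto
      show "m x \<in> ports v" using a by (cases "m x") (auto simp: ports_def)
      show "m x \<notin> ?H"
      proof
        assume "m x \<in> ?H"
        then obtain e b where e: "m x = Half e b" "e \<in> F" by blast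
        then have "m (Half e b) = Half e (\<not> b)" using F_iff[of e b] by (auto simp: F_def)
        then show False using a(3) e(1) j by simp
      qed
    qed
    have HP: "?H \<subseteq> ports v" by (auto simp: ports_def F_def)
    have "card (m ` ?D) = card ?D"
      by (intro card_image inj_on_subset[OF inj]) (use v in auto)
    also have "\<dots> = d\<^sub>2" by (simp add: card_image inj_on_def)
    finally have "card (m ` ?D) = d\<^sub>2" .
    moreover have "card (?H \<union> m ` ?D) = card ?H + card (m ` ?D)"
      using D HP finP by (intro card_Un_disjoint) (auto intro: finite_subset)
    moreover have "card (?H \<union> m ` ?D) \<le> card (ports v)"
      using D HP finP by (intro card_mono) auto
    ultimately have "card ?H \<le> d\<^sub>1" using card_ports[OF v] by linarith
    moreover have "F \<subseteq> edges G" by (auto simp: F_def)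
    ultimately show ?thesis using degree_eq_card_half_edges[of F v] by (simp add: card_Half_image)
  qed
  moreover have "F \<subseteq> edges G" by (auto simp: F_def)
  ultimately show ?thesis by blast
qed

section \<open>The charge received by an odd set\<close>

lemma charge_into_ge_pairs:
  assumes "C \<subseteq> required" and "S \<subseteq> C \<times> (nodes - C)" and "\<And>c u. (c, u) \<in> S \<Longrightarrow> charge u c \<ge> 1"
  shows "card S \<le> (\<Sum>c\<in>C. \<Sum>u\<in>nodes - C. charge u c)"
proof -
  have fin: "finite C" "finite (nodes - C)"
    using assms(1) finite_nodes by (auto intro: finite_subset[of C required])
  have "card S = (\<Sum>p\<in>S. 1)" by simp
  also have "\<dots> \<le> (\<Sum>p\<in>S. charge (snd p) (fst p))" using assms(3) by (intro sum_mono) auto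
  also have "\<dots> \<le> (\<Sum>p\<in>C \<times> (nodes - C). charge (snd p) (fst p))"
    using assms(2) fin by (intro sum_mono2) auto
  also have "\<dots> = (\<Sum>c\<in>C. \<Sum>u\<in>nodes - C. charge u c)"
    unfolding sum.cartesian_product by (simp only: case_prod_unfold)
  finally show ?thesis .
qed

text \<open>
  Every port of \<open>v\<close> is adjacent to a dummy on the other side of \<open>C\<close>, and the charge
  on this pair of nodes that points into \<open>C\<close> is at least \<open>1\<close>.
\<close>

lemma charge_into_divided_dummies:
  assumes C: "C \<subseteq> required" and v: "v \<in> verts G"
    and j: "j < d\<^sub>2" "Dummy v j \<in> C" and i: "i < d\<^sub>2" "Dummy v i \<notin> C"
  shows "d\<^sub>1 + d\<^sub>2 \<le> (\<Sum>c\<in>C. \<Sum>u\<in>nodes - C. charge u c)"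
proof -
  define pr where "pr p = (if p \<in> C then (p, Dummy v i) else (Dummy v j, p))" for p
  have "Dummy v j \<notin> ports v" "Dummy v i \<notin> ports v" by (auto simp: ports_def)
  then have "inj_on pr (ports v)" by (auto simp: inj_on_def pr_def split: if_splits)
  then have "d\<^sub>1 + d\<^sub>2 = card (pr ` ports v)" by (simp add: card_image card_ports[OF v])
  also have "\<dots> \<le> (\<Sum>c\<in>C. \<Sum>u\<in>nodes - C. charge u c)"
  proof (rule charge_into_ge_pairs[OF C])
    show "pr ` ports v \<subseteq> C \<times> (nodes - C)"
      using ports_subset_nodes[OF v] i j v by (auto simp: pr_def)
    fix c u assume "(c, u) \<in> pr ` ports v"
    then obtain p where p: "p \<in> ports v" "pr p = (c, u)" by force
    have "Free w k \<notin> C" for w k using C by (auto dest: subsetD)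
    then show "charge u c \<ge> 1" using p by (auto simp: ports_def pr_def split: if_splits)
  qed
  finally show ?thesis .
qed

lemma charge_into_free:
  assumes C: "C \<subseteq> required" and v: "v \<in> verts G" and free: "degree G v < d\<^sub>1 + d\<^sub>2"
    and all: "\<And>j. j < d\<^sub>2 \<Longrightarrow> Dummy v j \<in> C"
  shows "d\<^sub>1 + d\<^sub>2 \<le> (\<Sum>c\<in>C. \<Sum>u\<in>nodes - C. charge u c)"
proof -
  obtain k where k: "d\<^sub>2 = Suc k" using pos by (cases d\<^sub>2) auto
  have finC: "finite C" using C finite_nodes finite_subset by blast
  have free_in: "Free v 0 \<in> nodes - C" using v free C by (auto dest: subsetD)
  have "d\<^sub>1 + d\<^sub>2 = (\<Sum>j<d\<^sub>2. charge (Free v 0) (Dummy v j))"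
    unfolding k by (simp add: sum.lessThan_Suc_shift del: sum.lessThan_Suc)
  also have "\<dots> = (\<Sum>c\<in>Dummy v ` {..<d\<^sub>2}. charge (Free v 0) c)"
    by (subst sum.reindex) (auto simp: inj_on_def)
  also have "\<dots> \<le> (\<Sum>c\<in>C. charge (Free v 0) c)"
    using all finC by (intro sum_mono2) auto
  also have "\<dots> \<le> (\<Sum>c\<in>C. \<Sum>u\<in>nodes - C. charge u c)"
    using free_in finite_nodes by (intro sum_mono member_le_sum) auto
  finally show ?thesis .
qed

text \<open>
  Here \<open>g e b\<close> collects what the half-edge \<open>(e, b)\<close> contributes: if it is in \<open>C\<close>, what it receives
  from its other half and from the dummies of its vertex; if not, what it gives to the dummies.
  The charge from a half-edge outside \<open>C\<close> to its other half in \<open>C\<close> is attributed to the latter.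
\<close>

lemma charge_into_union_of_dummies:
  assumes C: "C \<subseteq> required"
    and dum: "\<And>v j. v \<in> verts G \<Longrightarrow> j < d\<^sub>2 \<Longrightarrow> Dummy v j \<in> C \<longleftrightarrow> v \<in> A"
  defines "g \<equiv> \<lambda>e b. if Half e b \<in> C
      then (if Half e (\<not> b) \<in> C then 0 else d\<^sub>1) + (if tip e b \<in> A then 0 else d\<^sub>2)
      else if tip e b \<in> A then d\<^sub>2 else 0"
  shows "(\<Sum>e\<in>edges G. g e True + g e False) \<le> (\<Sum>c\<in>C. \<Sum>u\<in>nodes - C. charge u c)"
proof -
  define h where "h x = (case x of Half e b \<Rightarrow> g e b | _ \<Rightarrow> 0)"
    for x :: "('v, 'e) gadget"
  have sum_dum: "(\<Sum>x\<in>Dummy w ` {..<d\<^sub>2}. f x) = (\<Sum>j<d\<^sub>2. f (Dummy w j))"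
    for w and f :: "('v, 'e) gadget \<Rightarrow> nat"
    by (subst sum.reindex) (auto simp: inj_on_def)
  have inside: "h c \<le> (\<Sum>u\<in>nodes - C. charge u c)" if c: "c \<in> halves \<inter> C" for c
  proof -
    obtain e b where e: "c = Half e b" "e \<in> edges G" using c by (auto simp: halves_def)
    define X where "X = (if Half e (\<not> b) \<in> C then {} else {Half e (\<not> b) :: ('v, 'e) gadget})"
    define Y where "Y = (if tip e b \<in> A then {} else Dummy (tip e b) ` {..<d\<^sub>2} :: ('v, 'e) gadget set)"
    have "h c = (\<Sum>u\<in>X. charge u c) + (\<Sum>u\<in>Y. charge u c)"
      using c e by (auto simp: h_def g_def X_def Y_def sum_dum)
    also have "\<dots> = (\<Sum>u\<in>X \<union> Y. charge u c)"
      by (intro sum.union_disjoint[symmetric]) (auto simp: X_def Y_def)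
    also have "\<dots> \<le> (\<Sum>u\<in>nodes - C. charge u c)"
    proof (rule sum_mono2)
      show "X \<union> Y \<subseteq> nodes - C"
        using e tip_in_verts[OF e(2)] dum by (auto simp: X_def Y_def)
    qed (use finite_nodes in auto)
    finally show ?thesis .
  qed
  have outside: "h u \<le> (\<Sum>c\<in>C \<inter> dummies. charge u c)" if u: "u \<in> halves - C" for u
  proof -
    obtain e b where e: "u = Half e b" "e \<in> edges G" using u by (auto simp: halves_def)
    show ?thesis
    proof (cases "tip e b \<in> A")
      case True
      have "h u = (\<Sum>c\<in>Dummy (tip e b) ` {..<d\<^sub>2}. charge u c)"
        using u e True by (simp add: h_def g_def sum_dum)
      also have "\<dots> \<le> (\<Sum>c\<in>C \<inter> dummies. charge u c)"
        using dum tip_in_verts[OF e(2)] True finite_nodes by (intro sum_mono2) auto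
      finally show ?thesis .
    qed (use u e in \<open>simp add: h_def g_def\<close>)
  qed
  have "(\<Sum>e\<in>edges G. g e True + g e False) = (\<Sum>x\<in>halves. h x)"
    unfolding sum_halves by (simp add: h_def UNIV_bool add.commute)
  also have "\<dots> = (\<Sum>x\<in>halves \<inter> C. h x) + (\<Sum>x\<in>halves - C. h x)"
    using finite_nodes by (intro sum.Int_Diff)
  also have "\<dots> \<le> (\<Sum>c\<in>halves \<inter> C. \<Sum>u\<in>nodes - C. charge u c)
      + (\<Sum>c\<in>C \<inter> dummies. \<Sum>u\<in>nodes - C. charge u c)"
  proof (rule add_mono)
    show "(\<Sum>x\<in>halves \<inter> C. h x) \<le> (\<Sum>c\<in>halves \<inter> C. \<Sum>u\<in>nodes - C. charge u c)"
      using inside by (rule sum_mono)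
    have "(\<Sum>x\<in>halves - C. h x) \<le> (\<Sum>u\<in>halves - C. \<Sum>c\<in>C \<inter> dummies. charge u c)"
      using outside by (rule sum_mono)
    also have "\<dots> = (\<Sum>c\<in>C \<inter> dummies. \<Sum>u\<in>halves - C. charge u c)"
      by (rule sum.swap)
    also have "\<dots> \<le> (\<Sum>c\<in>C \<inter> dummies. \<Sum>u\<in>nodes - C. charge u c)"
      using finite_nodes by (intro sum_mono sum_mono2) auto
    finally show "(\<Sum>x\<in>halves - C. h x) \<le> \<dots>" .
  qed
  also have "\<dots> = (\<Sum>c\<in>(halves \<inter> C) \<union> (C \<inter> dummies). \<Sum>u\<in>nodes - C. charge u c)"
    using finite_nodes halves_dummies_disjoint by (intro sum.union_disjoint[symmetric]) auto
  also have "(halves \<inter> C) \<union> (C \<inter> dummies) = C" using C by auto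
  finally show ?thesis by simp
qed

lemma card_gadget_set:
  assumes C: "C \<subseteq> required" and A: "A \<subseteq> verts G"
    and dum: "\<And>v j. v \<in> verts G \<Longrightarrow> j < d\<^sub>2 \<Longrightarrow> Dummy v j \<in> C \<longleftrightarrow> v \<in> A"
  shows "card C = card {(e, b). Half e b \<in> C} + card A * d\<^sub>2"
proof -
  have decomp: "C = {Half e b | e b. e \<in> UNIV \<and> Half e b \<in> C} \<union> (\<lambda>(v, j). Dummy v j) ` (A \<times> {..<d\<^sub>2})"
    (is "_ = ?H \<union> ?D")
  proof
    show "C \<subseteq> ?H \<union> ?D"
    proof
      fix x assume x: "x \<in> C"
      then have "x \<in> required" using C by blast
      then show "x \<in> ?H \<union> ?D" using x dum by (cases x) auto
    qed
    show "?H \<union> ?D \<subseteq> C" using dum A by auto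
  qed
  have "card C = card (?H \<union> ?D)" using decomp by (rule arg_cong)
  also have "\<dots> = card ?H + card ?D"
  proof (rule card_Un_disjoint)
    have "finite C" using C finite_nodes finite_subset by blast
    then show "finite ?H" by (rule finite_subset[rotated]) auto
    show "finite ?D" using A finite_verts by (auto intro: finite_subset)
  qed auto
  also have "card ?H = card {(e, b). Half e b \<in> C}"
    by (simp only: card_Half_image) simp
  also have "card ?D = card A * d\<^sub>2"
  proof -
    have "inj_on (\<lambda>(v, j). Dummy v j :: ('v, 'e) gadget) (A \<times> {..<d\<^sub>2})"
      by (auto simp: inj_on_def)
    then show ?thesis by (simp add: card_image card_cartesian_product)
  qed
  finally show ?thesis .
qed

text \<open>
  In the last case an edge that contributes less than \<open>d\<^sub>1 + d\<^sub>2\<close> has its two halves on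
  different sides of \<open>C\<close> only if it belongs to the cut of \<open>A\<close>. These edges form the set \<open>S\<close> of
  the proof, and the other edges of the cut form \<open>T\<close>. All other edges have an even number of halves in \<open>C\<close>,
  so the parity of \<open>C\<close> determines that of \<open>S\<close>.
\<close>

lemma charge_into_odd:
  assumes cuts: "\<And>A a b. A \<subseteq> {v \<in> verts G. degree G v = d\<^sub>1 + d\<^sub>2} \<Longrightarrow> a + b = cut_degree G A \<Longrightarrow>
      odd (card A * d\<^sub>2 + a) \<Longrightarrow> d\<^sub>1 + d\<^sub>2 \<le> d\<^sub>1 * a + d\<^sub>2 * b"
    and C: "C \<subseteq> required" and odd: "odd (card C)"
  shows "d\<^sub>1 + d\<^sub>2 \<le> (\<Sum>c\<in>C. \<Sum>u\<in>nodes - C. charge u c)"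
proof -
  define A where "A = {v \<in> verts G. Dummy v 0 \<in> C}"
  have AV: "A \<subseteq> verts G" by (auto simp: A_def)
  consider (divided) v j i where "v \<in> verts G" "j < d\<^sub>2" "Dummy v j \<in> C" "i < d\<^sub>2" "Dummy v i \<notin> C"
    | (free) v where "v \<in> A" "degree G v < d\<^sub>1 + d\<^sub>2" "\<And>j. j < d\<^sub>2 \<Longrightarrow> Dummy v j \<in> C"
    | (saturated) "A \<subseteq> {v \<in> verts G. degree G v = d\<^sub>1 + d\<^sub>2}"
        "\<And>v j. v \<in> verts G \<Longrightarrow> j < d\<^sub>2 \<Longrightarrow> Dummy v j \<in> C \<longleftrightarrow> v \<in> A"
  proof (cases "\<exists>v\<in>verts G. \<exists>j<d\<^sub>2. \<exists>i<d\<^sub>2. Dummy v j \<in> C \<and> Dummy v i \<notin> C")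
    case True
    then show ?thesis using divided by blast
  next
    case False
    have dum: "Dummy v j \<in> C \<longleftrightarrow> v \<in> A" if v: "v \<in> verts G" and j: "j < d\<^sub>2" for v j
    proof -
      have "Dummy v j \<in> C \<longleftrightarrow> Dummy v 0 \<in> C" using False v j pos(2) by meson
      then show ?thesis using v by (simp add: A_def)
    qed
    show ?thesis
    proof (cases "\<exists>v\<in>A. degree G v < d\<^sub>1 + d\<^sub>2")
      case True
      then obtain v where v: "v \<in> A" "degree G v < d\<^sub>1 + d\<^sub>2" by blast
      then show ?thesis using free[of v] dum AV by blast
    next
      case F: False
      have "A \<subseteq> {v \<in> verts G. degree G v = d\<^sub>1 + d\<^sub>2}"
      proof
        fix v assume v: "v \<in> A"
        then have "v \<in> verts G" "\<not> degree G v < d\<^sub>1 + d\<^sub>2" using F AV by auto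
        then show "v \<in> {v \<in> verts G. degree G v = d\<^sub>1 + d\<^sub>2}" using degree_le[of v] by simp
      qed
      then show ?thesis using saturated dum by blast
    qed
  qed
  then show ?thesis
  proof cases
    case divided
    then show ?thesis using charge_into_divided_dummies[OF C] by blast
  next
    case free
    then show ?thesis using charge_into_free[OF C, of v] AV by blast
  next
    case saturated
    define g where "g e b = (if Half e b \<in> C
      then (if Half e (\<not> b) \<in> C then 0 else d\<^sub>1) + (if tip e b \<in> A then 0 else d\<^sub>2)
      else if tip e b \<in> A then d\<^sub>2 else 0)" for e b
    have total: "(\<Sum>e\<in>edges G. g e True + g e False) \<le> (\<Sum>c\<in>C. \<Sum>u\<in>nodes - C. charge u c)"
      unfolding g_def by (rule charge_into_union_of_dummies[OF C saturated(2)])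
    show ?thesis
    proof (cases "\<exists>e\<in>edges G. d\<^sub>1 + d\<^sub>2 \<le> g e True + g e False")
      case True
      then obtain e where e: "e \<in> edges G" "d\<^sub>1 + d\<^sub>2 \<le> g e True + g e False" by blast
      have "g e True + g e False \<le> (\<Sum>e\<in>edges G. g e True + g e False)"
        using finite_edges e(1) by (intro member_le_sum) auto
      then show ?thesis using total e(2) by linarith
    next
      case False
      define S where "S = {e \<in> edges G. (tip e True \<in> A) \<noteq> (tip e False \<in> A) \<and>
        (Half e True \<in> C) \<noteq> (Half e False \<in> C)}"
      define T where "T = {e \<in> edges G. (tip e True \<in> A) \<noteq> (tip e False \<in> A) \<and>
        (Half e True \<in> C) = (Half e False \<in> C)}"
      have finST: "finite S" "finite T" using finite_edges by (auto simp: S_def T_def)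
      have uncut: "(Half e True \<in> C) = (Half e False \<in> C)"
        if e: "e \<in> edges G" and tips: "(tip e True \<in> A) = (tip e False \<in> A)" for e
      proof -
        have "\<not> d\<^sub>1 + d\<^sub>2 \<le> g e True + g e False" using False e by blast
        then show ?thesis using tips by (auto simp: g_def split: if_splits)
      qed
      have gS: "d\<^sub>1 \<le> g e True + g e False" if "e \<in> S" for e
        using that by (auto simp: g_def S_def)
      have gT: "d\<^sub>2 \<le> g e True + g e False" if "e \<in> T" for e
        using that by (auto simp: g_def T_def)
      have "{(e, b). Half e b \<in> C} \<subseteq> edges G \<times> UNIV" using C by (auto dest: subsetD)
      then have "even (card {(e, b). Half e b \<in> C}) \<longleftrightarrow>
          even (card {e \<in> edges G. (Half e True \<in> C) \<noteq> (Half e False \<in> C)})"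
        using even_card_half_edges by simp
      moreover have "{e \<in> edges G. (Half e True \<in> C) \<noteq> (Half e False \<in> C)} = S"
        using uncut by (auto simp: S_def)
      ultimately have "odd (card A * d\<^sub>2 + card S)"
        using odd card_gadget_set[OF C AV saturated(2)] by simp
      moreover have "card S + card T = cut_degree G A"
      proof -
        have "card S + card T = card (S \<union> T)"
          using finST by (intro card_Un_disjoint[symmetric]) (auto simp: S_def T_def)
        also have "S \<union> T = {e \<in> edges G. (tip e True \<in> A) \<noteq> (tip e False \<in> A)}"
          by (auto simp: S_def T_def)
        finally show ?thesis by (simp add: cut_degree_eq)
      qed
      ultimately have "d\<^sub>1 + d\<^sub>2 \<le> d\<^sub>1 * card S + d\<^sub>2 * card T"
        using cuts[OF saturated(1)] by blast
      also have "\<dots> = (\<Sum>e\<in>S. d\<^sub>1) + (\<Sum>e\<in>T. d\<^sub>2)" by (simp add: mult.commute)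
      also have "\<dots> \<le> (\<Sum>e\<in>S. g e True + g e False) + (\<Sum>e\<in>T. g e True + g e False)"
        using gS gT by (intro add_mono sum_mono)
      also have "\<dots> = (\<Sum>e\<in>S \<union> T. g e True + g e False)"
        using finST by (intro sum.union_disjoint[symmetric]) (auto simp: S_def T_def)
      also have "\<dots> \<le> (\<Sum>e\<in>edges G. g e True + g e False)"
        using finite_edges by (intro sum_mono2) (auto simp: S_def T_def)
      finally show ?thesis using total by linarith
    qed
  qed
qed

text \<open>
  In the hypothesis, \<open>a\<close> and \<open>b\<close> stand for the sizes of \<open>S\<close> and \<open>T\<close> in the previous proof, of which only
  the sum and the parity can be controlled. The inequality can fail only if \<open>a\<close> or \<open>b\<close> is \<open>0\<close>.
\<close>

theorem degree_split_of_cuts: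
  assumes cuts: "\<And>A a b. A \<subseteq> {v \<in> verts G. degree G v = d\<^sub>1 + d\<^sub>2} \<Longrightarrow> a + b = cut_degree G A \<Longrightarrow>
      odd (card A * d\<^sub>2 + a) \<Longrightarrow> d\<^sub>1 + d\<^sub>2 \<le> d\<^sub>1 * a + d\<^sub>2 * b"
  shows "\<exists>F\<subseteq>edges G. \<forall>v\<in>verts G. degree (G\<lparr>edges := F\<rparr>) v \<le> d\<^sub>1
    \<and> degree (G\<lparr>edges := edges G - F\<rparr>) v \<le> d\<^sub>2"
proof -
  have "\<exists>m. matching nodes (gadget_adj tip) m \<and> (\<forall>x\<in>required. m x \<noteq> x)"
  proof (rule matching_covering_from_charges[where ch = charge and D = "d\<^sub>1 + d\<^sub>2"])
    show "finite nodes" using finite_nodes by simp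
    show "required \<subseteq> nodes" by blast
    show "d\<^sub>1 + d\<^sub>2 > 0" using pos by simp
    show "d\<^sub>1 + d\<^sub>2 \<le> (\<Sum>c\<in>C. \<Sum>u\<in>nodes - C. charge u c)"
      if "C \<subseteq> required" "odd (card C)" for C
      using cuts that by (rule charge_into_odd)
  qed (fact gadget_adj_sym gadget_adj_irrefl gadget_charge_adj charge_row_le)+
  then show ?thesis using degree_split_of_matching by blast
qed

end

section \<open>The decomposition\<close>

lemma ex_orientation:
  assumes "wf_multigraph G"
  shows "\<exists>tip. oriented_multigraph G tip"
proof -
  have "\<exists>a. ends G e = {a True, a False}" if "e \<in> edges G" for e
  proof -
    have "card (ends G e) = 1 \<or> card (ends G e) = 2"
      using assms that by (auto simp: wf_multigraph_def)
    then obtain x y where "ends G e = {x, y}"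
      by (auto simp: card_1_singleton_iff card_2_iff)
    then show ?thesis by (intro exI[of _ "\<lambda>b. if b then x else y"]) simp
  qed
  then obtain tip where "\<And>e. e \<in> edges G \<Longrightarrow> ends G e = {tip e True, tip e False}" by metis
  then show ?thesis using assms by (auto simp: oriented_multigraph_def)
qed

lemma le_mult_of_ceiling_le:
  assumes "d > 0" and "nat \<lceil>real n / real d\<rceil> \<le> c"
  shows "n \<le> d * c"
proof -
  have "real n / real d \<le> real c" using assms(2) by linarith
  then have "real n \<le> real (d * c)" using assms(1) by (simp add: field_simps)
  then show ?thesis by linarith
qed

theorem corollary7p5:
  fixes G :: "('v, 'e) multigraph" and V\<^sub>0 :: "'v set" and \<Delta>\<^sub>1 \<Delta>\<^sub>2 :: nat
  assumes "\<Delta>\<^sub>1 > 0" and "\<Delta>\<^sub>2 > 0"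
    and "wf_multigraph G" and "connected_multigraph G"
    and "V\<^sub>0 = {v \<in> verts G. degree G v = \<Delta>\<^sub>1 + \<Delta>\<^sub>2}"
    and "max_degree G \<le> \<Delta>\<^sub>1 + \<Delta>\<^sub>2"
    and "(even \<Delta>\<^sub>1 \<and> even \<Delta>\<^sub>2)
       \<or> (odd \<Delta>\<^sub>1 \<and> even \<Delta>\<^sub>2 \<and>
          partially_odd_edge_connected G V\<^sub>0 (nat \<lceil>real (\<Delta>\<^sub>1 + \<Delta>\<^sub>2) / real \<Delta>\<^sub>1\<rceil>))
       \<or> (odd \<Delta>\<^sub>1 \<and> odd \<Delta>\<^sub>2 \<and> (even (card (verts G)) \<or> V\<^sub>0 \<noteq> verts G) \<and>
          partially_odd_edge_connected_wrt G V\<^sub>0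
            (nat \<lceil>real (\<Delta>\<^sub>1 + \<Delta>\<^sub>2) / real (min \<Delta>\<^sub>1 \<Delta>\<^sub>2)\<rceil>) V\<^sub>0)"
  shows "\<exists>G\<^sub>1 G\<^sub>2. edge_decomposed G G\<^sub>1 G\<^sub>2 \<and> max_degree G\<^sub>1 \<le> \<Delta>\<^sub>1 \<and> max_degree G\<^sub>2 \<le> \<Delta>\<^sub>2"
proof -
  have verts: "finite (verts G)" "verts G \<noteq> {}"
    using assms(3,4) by (auto simp: wf_multigraph_def connected_multigraph_def)
  have max_degree_le: "max_degree H \<le> d \<longleftrightarrow> (\<forall>v\<in>verts G. degree H v \<le> d)"
    if "verts H = verts G" for H :: "('v, 'e) multigraph" and d
    using verts that by (simp add: max_degree_def)
  obtain tip where "oriented_multigraph G tip" using ex_orientation[OF assms(3)] by blast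
  then interpret oriented_multigraph G tip .
  interpret degree_gadget G tip \<Delta>\<^sub>1 \<Delta>\<^sub>2
    by unfold_locales (use assms(1,2,6) max_degree_le[of G] in auto)
  have cuts: "\<Delta>\<^sub>1 + \<Delta>\<^sub>2 \<le> \<Delta>\<^sub>1 * a + \<Delta>\<^sub>2 * b"
    if A: "A \<subseteq> {v \<in> verts G. degree G v = \<Delta>\<^sub>1 + \<Delta>\<^sub>2}" and ab: "a + b = cut_degree G A"
      and odd: "odd (card A * \<Delta>\<^sub>2 + a)" for A a b
  proof (cases "a = 0 \<or> b = 0")
    case False
    then have "\<Delta>\<^sub>1 \<le> \<Delta>\<^sub>1 * a" "\<Delta>\<^sub>2 \<le> \<Delta>\<^sub>2 * b" by simp_all
    then show ?thesis by (rule add_mono)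
  next
    case zero: True
    have "(\<Sum>v\<in>A. degree G v) = (\<Sum>v\<in>A. \<Delta>\<^sub>1 + \<Delta>\<^sub>2)" using A by (intro sum.cong) auto
    then have "even (card A * (\<Delta>\<^sub>1 + \<Delta>\<^sub>2)) \<longleftrightarrow> even (a + b)"
      using even_sum_degree_iff[of A] A ab by auto
    \<comment> \<open>The degree sum over \<open>A\<close> turns the parity condition on \<open>a\<close> into its mirror image for \<open>b\<close>.\<close>
    then have par: "odd (card A * \<Delta>\<^sub>1 + b)" using odd by auto
    have AV: "A \<subseteq> V\<^sub>0" using A assms(5) by simp
    from assms(7) consider (even) "even \<Delta>\<^sub>1" "even \<Delta>\<^sub>2"
      | (mixed) "odd \<Delta>\<^sub>1" "even \<Delta>\<^sub>2"
          "partially_odd_edge_connected G V\<^sub>0 (nat \<lceil>real (\<Delta>\<^sub>1 + \<Delta>\<^sub>2) / real \<Delta>\<^sub>1\<rceil>)"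
      | (odd) "odd \<Delta>\<^sub>1" "odd \<Delta>\<^sub>2" "partially_odd_edge_connected_wrt G V\<^sub>0
            (nat \<lceil>real (\<Delta>\<^sub>1 + \<Delta>\<^sub>2) / real (min \<Delta>\<^sub>1 \<Delta>\<^sub>2)\<rceil>) V\<^sub>0"
      by blast
    then show ?thesis
    proof cases
      case even
      then show ?thesis using odd par zero by auto
    next
      case mixed
      then have "odd a" using odd by simp
      then have "b = 0" using zero by auto
      then have "odd (cut_degree G A)" using \<open>odd a\<close> ab by simp
      moreover from this have "A \<noteq> {}" by (auto simp: cut_degree_def)
      ultimately have "nat \<lceil>real (\<Delta>\<^sub>1 + \<Delta>\<^sub>2) / real \<Delta>\<^sub>1\<rceil> \<le> cut_degree G A"
        using mixed(3) AV by (auto simp: partially_odd_edge_connected_def)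
      then show ?thesis
        using le_mult_of_ceiling_le[OF assms(1)] ab \<open>b = 0\<close> by auto
    next
      case odd
      have "odd (card (A \<inter> V\<^sub>0))"
        using zero \<open>odd (card A * \<Delta>\<^sub>2 + a)\<close> par AV by (auto simp: Int_absorb2)
      then have "nat \<lceil>real (\<Delta>\<^sub>1 + \<Delta>\<^sub>2) / real (min \<Delta>\<^sub>1 \<Delta>\<^sub>2)\<rceil> \<le> cut_degree G A"
        using odd(3) AV by (auto simp: partially_odd_edge_connected_wrt_def)
      then have "\<Delta>\<^sub>1 + \<Delta>\<^sub>2 \<le> min \<Delta>\<^sub>1 \<Delta>\<^sub>2 * (a + b)"
        using le_mult_of_ceiling_le[of "min \<Delta>\<^sub>1 \<Delta>\<^sub>2"] assms(1,2) ab by simp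
      also have "\<dots> = min \<Delta>\<^sub>1 \<Delta>\<^sub>2 * a + min \<Delta>\<^sub>1 \<Delta>\<^sub>2 * b" by (rule distrib_left)
      also have "\<dots> \<le> \<Delta>\<^sub>1 * a + \<Delta>\<^sub>2 * b" by (intro add_mono mult_le_mono1) auto
      finally show ?thesis .
    qed
  qed
  have "\<exists>F\<subseteq>edges G. \<forall>v\<in>verts G. degree (G\<lparr>edges := F\<rparr>) v \<le> \<Delta>\<^sub>1
      \<and> degree (G\<lparr>edges := edges G - F\<rparr>) v \<le> \<Delta>\<^sub>2"
    using cuts by (rule degree_split_of_cuts)
  then obtain F where F: "F \<subseteq> edges G"
    and deg: "\<forall>v\<in>verts G. degree (G\<lparr>edges := F\<rparr>) v \<le> \<Delta>\<^sub>1
      \<and> degree (G\<lparr>edges := edges G - F\<rparr>) v \<le> \<Delta>\<^sub>2"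
    by (elim exE conjE)
  have "edge_decomposed G (G\<lparr>edges := F\<rparr>) (G\<lparr>edges := edges G - F\<rparr>)"
    using F by (auto simp: edge_decomposed_def factor_of_def)
  moreover have "max_degree (G\<lparr>edges := F\<rparr>) \<le> \<Delta>\<^sub>1" "max_degree (G\<lparr>edges := edges G - F\<rparr>) \<le> \<Delta>\<^sub>2"
    using deg by (simp_all add: max_degree_le)
  ultimately show ?thesis by blast
qed

end
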